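(* For every positive integer $D$, there exist a 2-degenerate graph $G$ with $\Delta(G)\le D$ and a clique $S'$ in $G^2$ with $|S'|\ge g(D)-460$.
   Context: $g(D)$ denotes the maximum size of a clique in $G^2$ over all graphs $G$ with $\mathrm{mad}(G)<4$ and $\Delta(G)\le D$, where $\mathrm{mad}(G)=\max_{H\subseteq G}2|E(H)|/|V(H)|$. The square $G^2$ is obtained from $G$ by adding an edge between every pair of vertices at distance 2 in $G$. *)

theory Defs
  imports Complex_Main
begin

definition simple_graph :: "'a set \<Rightarrow> 'a set set \<Rightarrow> bool" where
  "simple_graph V E \<longleftrightarrow> finite V \<and>
     (\<forall>e\<in>E. \<exists>u v. u \<in> V \<and> v \<in> V \<and> u \<noteq> v \<and> e = {u, v})"

definition degree :: "'a set set \<Rightarrow> 'a \<Rightarrow> nat" where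
  "degree E v = card {u. {u, v} \<in> E}"

definition max_degree :: "'a set \<Rightarrow> 'a set set \<Rightarrow> nat" where
  "max_degree V E = (if V = {} then 0 else Max (degree E ` V))"

definition subgraph :: "'a set \<Rightarrow> 'a set set \<Rightarrow> 'a set \<Rightarrow> 'a set set \<Rightarrow> bool" where
  "subgraph W F V E \<longleftrightarrow> W \<subseteq> V \<and> F \<subseteq> E \<and> (\<forall>e\<in>F. e \<subseteq> W)"

definition mad :: "'a set \<Rightarrow> 'a set set \<Rightarrow> real" where
  "mad V E = (if V = {} then 0 else
     Max {2 * real (card F) / real (card W) | W F. subgraph W F V E \<and> W \<noteq> {}})"

definition degenerate :: "nat \<Rightarrow> 'a set \<Rightarrow> 'a set set \<Rightarrow> bool" where
  "degenerate k V E \<longleftrightarrow> (\<forall>W F. subgraph W F V E \<and> W \<noteq> {} \<longrightarrow>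
      (\<exists>v\<in>W. card {u. {u, v} \<in> F} \<le> k))"

definition sq_adj :: "'a set \<Rightarrow> 'a set set \<Rightarrow> 'a \<Rightarrow> 'a \<Rightarrow> bool" where
  "sq_adj V E u v \<longleftrightarrow> u \<noteq> v \<and> ({u, v} \<in> E \<or> (\<exists>w\<in>V. {u, w} \<in> E \<and> {w, v} \<in> E))"

definition sq_clique :: "'a set \<Rightarrow> 'a set set \<Rightarrow> 'a set \<Rightarrow> bool" where
  "sq_clique V E S \<longleftrightarrow> S \<subseteq> V \<and> (\<forall>u\<in>S. \<forall>v\<in>S. u \<noteq> v \<longrightarrow> sq_adj V E u v)"

text \<open>g(D): maximum clique size in G^2 over finite graphs with mad < 4 and max degree \<le> D.
  Every finite graph is isomorphic to one on natural-number vertices.\<close>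
definition g :: "nat \<Rightarrow> nat" where
  "g D = Sup {card S | (V :: nat set) E S. simple_graph V E \<and> mad V E < 4 \<and>
                max_degree V E \<le> D \<and> sq_clique V E S}"

end

theory Submission
  imports Defs "HOL-Library.Nat_Bijection"
begin

text \<open>
  We show \<open>g(D) \<le> 5D/2 + 240\<close>; a 2-degenerate graph whose square has a clique of
  size \<open>10 \<lfloor>D/4\<rfloor>\<close> then suffices. Since mad is less than 4, the graph has an orientation with all
  outdegrees at most 2. Two clique vertices \<open>u\<close>, \<open>v\<close> have a common out-neighbour (a hub), or a common
  in-neighbour, or one reaches the other by a directed path of length at most 2. The last kind of
  pair is rare, as every vertex reaches at most 6 others, and each vertex has at most \<open>D\<close> partners of
  the second kind. Hence \<open>N \<le> d(i) + d(j) - m(i, j) + D + O(1)\<close> for almost every clique vertex with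
  hubs \<open>i\<close>, \<open>j\<close>, where \<open>N\<close> is the size of the clique, \<open>d(i) \<le> D\<close> the number of clique vertices using
  the hub \<open>i\<close> and \<open>m(i, j)\<close> the number using both. At most five hubs serve at most \<open>5D/2\<close> clique
  vertices. With six or more hubs, summing the inequality over the neighbours \<open>j\<close> of the hub \<open>i\<close> of
  smallest degree gives the same bound up to an additive constant.
\<close>

section \<open>Orientations of sparse graphs\<close>

text \<open>Hall's theorem with capacity \<open>c\<close>, by Rado's argument: while some
  \<open>A i\<close> has two elements, one can be discarded without breaking the Hall condition.
  With \<open>c = 2\<close> it orients the edges.\<close>

lemma bounded_choice:
  fixes A :: "'i \<Rightarrow> 'a set"
  assumes "finite I" "\<And>i. i \<in> I \<Longrightarrow> finite (A i)"
    and "\<And>J. J \<subseteq> I \<Longrightarrow> card J \<le> c * card (\<Union>(A ` J))"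
  shows "\<exists>f. (\<forall>i\<in>I. f i \<in> A i) \<and> (\<forall>x. card {i\<in>I. f i = x} \<le> c)"
  using assms
proof (induction "\<Sum>i\<in>I. card (A i)" arbitrary: A rule: less_induct)
  case less
  note fin = less.prems(1,2) and hall = less.prems(3)
  have ne: "A i \<noteq> {}" if "i \<in> I" for i
    using hall[of "{i}"] that by auto
  show ?case
  proof (cases "\<exists>i\<in>I. \<exists>x\<in>A i. \<exists>y\<in>A i. x \<noteq> y")
    case False
    define f where "f i = (SOME x. x \<in> A i)" for i
    have f: "f i \<in> A i" if "i \<in> I" for i
      using ne[OF that] unfolding f_def by (simp add: some_in_eq)
    have "card {i\<in>I. f i = x} \<le> c" for x
    proof -
      have "\<Union>(A ` {i\<in>I. f i = x}) \<subseteq> {x}"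
        using False f by blast
      then have "card (\<Union>(A ` {i\<in>I. f i = x})) \<le> 1"
        using card_mono[of "{x}"] by simp
      then have "c * card (\<Union>(A ` {i\<in>I. f i = x})) \<le> c * 1"
        by (rule mult_le_mono2)
      moreover have "card {i\<in>I. f i = x} \<le> c * card (\<Union>(A ` {i\<in>I. f i = x}))"
        by (rule hall) auto
      ultimately show ?thesis by linarith
    qed
    with f show ?thesis by blast
  next
    case True
    then obtain i x y where i: "i \<in> I" and xy: "x \<in> A i" "y \<in> A i" "x \<noteq> y" by blast
    have dec: "\<exists>f. (\<forall>j\<in>I. f j \<in> A j) \<and> (\<forall>a. card {j\<in>I. f j = a} \<le> c)"
      if z: "z \<in> A i" and h: "\<And>J. J \<subseteq> I \<Longrightarrow> card J \<le> c * card (\<Union>((A(i := A i - {z})) ` J))" for z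
    proof -
      let ?B = "A(i := A i - {z})"
      have "(\<Sum>j\<in>I. card (?B j)) < (\<Sum>j\<in>I. card (A j))"
      proof (rule sum_strict_mono_ex1)
        show "\<forall>j\<in>I. card (?B j) \<le> card (A j)"
          using fin by (auto intro: card_mono)
        show "\<exists>j\<in>I. card (?B j) < card (A j)"
          using i z fin card_Diff1_less[of "A i" z] by (intro bexI[of _ i]) auto
      qed (use fin in auto)
      moreover have "finite (?B j)" if "j \<in> I" for j using fin(2) i that by simp
      ultimately obtain f where f: "\<forall>j\<in>I. f j \<in> ?B j" "\<forall>a. card {j\<in>I. f j = a} \<le> c"
        using less.hyps[of ?B, OF _ fin(1) _ h] by blast
      from f(1) have "\<forall>j\<in>I. f j \<in> A j" by (auto split: if_splits)
      with f(2) show ?thesis by blast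
    qed
    show ?thesis
    proof (rule ccontr)
      assume no: "\<nexists>f. (\<forall>i\<in>I. f i \<in> A i) \<and> (\<forall>x. card {i\<in>I. f i = x} \<le> c)"
      \<comment> \<open>If neither \<open>x\<close> nor \<open>y\<close> can be discarded from \<open>A i\<close>, submodularity of
        \<open>J \<mapsto> card (\<Union>(A ` J))\<close> combines the two violating sets into a violation for \<open>A\<close> (Rado).\<close>
      have viol: "\<exists>J U. J \<subseteq> I \<and> i \<notin> J \<and> U = \<Union>(A ` J) \<union> (A i - {z}) \<and> c * card U \<le> card J"
        if z: "z \<in> A i" for z
      proof -
        obtain J where J: "J \<subseteq> I" "card J > c * card (\<Union>((A(i := A i - {z})) ` J))"
          using dec[OF z] no by (meson not_le)
        have iJ: "i \<in> J"
        proof (rule ccontr)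
          assume "i \<notin> J"
          then have "(A(i := A i - {z})) ` J = A ` J" by (auto simp: image_def)
          with J(2) have "c * card (\<Union>(A ` J)) < card J" by (simp only:)
          with hall[OF J(1)] show False by simp
        qed
        have "\<Union>((A(i := A i - {z})) ` J) = \<Union>(A ` (J - {i})) \<union> (A i - {z})"
          using iJ by (auto split: if_splits)
        moreover have "card J = Suc (card (J - {i}))"
          using iJ J(1) fin(1) by (metis card.remove finite_subset)
        ultimately show ?thesis
          using J by (intro exI[of _ "J - {i}"]) auto
      qed
      obtain J U where J: "J \<subseteq> I" "i \<notin> J" "U = \<Union>(A ` J) \<union> (A i - {x})" "c * card U \<le> card J"
        using viol[OF xy(1)] by blast
      obtain K W where K: "K \<subseteq> I" "i \<notin> K" "W = \<Union>(A ` K) \<union> (A i - {y})" "c * card W \<le> card K"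
        using viol[OF xy(2)] by blast
      have fJK: "finite J" "finite K" using J K fin(1) by (auto intro: finite_subset)
      have fUW: "finite U" "finite W" using J K fJK fin i by auto
      \<comment> \<open>As \<open>x \<noteq> y\<close>, the set \<open>U \<union> W\<close> contains
        all of \<open>A i\<close>, so the index \<open>i\<close> adds 1 to the left side only. This
        surplus is the contradiction.\<close>
      have "card (insert i (J \<union> K)) \<le> c * card (\<Union>(A ` insert i (J \<union> K)))"
        using J K i by (intro hall) auto
      also have "\<Union>(A ` insert i (J \<union> K)) = U \<union> W" using J K xy by auto
      finally have 1: "card (J \<union> K) + 1 \<le> c * card (U \<union> W)"
        using J K fJK by simp
      have "card (J \<inter> K) \<le> c * card (\<Union>(A ` (J \<inter> K)))"
        using J by (intro hall) auto
      also have "\<dots> \<le> c * card (U \<inter> W)"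
        using J K fUW by (intro mult_le_mono2 card_mono) auto
      finally have "card (J \<union> K) + card (J \<inter> K) + 1 \<le> c * (card (U \<union> W) + card (U \<inter> W))"
        using 1 by (simp add: distrib_left)
      also have "\<dots> = c * card U + c * card W"
        using card_Un_Int[OF fUW] by (metis distrib_left)
      finally show False using J K card_Un_Int[OF fJK] by simp
    qed
  qed
qed

text \<open>The Hall condition for choosing a tail of each edge: the edges \<open>F\<close> on their
  own endpoints form a subgraph, whose density \<open>mad\<close> bounds.\<close>

lemma mad_less_imp_card_le:
  assumes G: "simple_graph V E" "mad V E < 4" and F: "F \<subseteq> E"
  shows "card F \<le> 2 * card (\<Union>F)"
proof (cases "F = {}")
  case False
  have EV: "e \<subseteq> V" "e \<noteq> {}" if "e \<in> E" for e
    using G(1) that unfolding simple_graph_def by auto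
  then have EP: "E \<subseteq> Pow V" by auto
  have fV: "finite V" using G(1) by (simp add: simple_graph_def)
  then have fE: "finite E" using EP finite_subset by auto
  let ?M = "{2 * real (card F) / real (card W) | W F. subgraph W F V E \<and> W \<noteq> {}}"
  have sub: "?M \<subseteq> (\<lambda>(W, F). 2 * real (card F) / real (card W)) ` (Pow V \<times> Pow E)"
    by (auto simp: subgraph_def)
  have "finite ?M" by (rule finite_subset[OF sub]) (use fV fE in auto)
  moreover have sg: "subgraph (\<Union>F) F V E" and ne: "\<Union>F \<noteq> {}"
    using F EV False by (auto simp: subgraph_def) blast+
  moreover have pos: "card (\<Union>F) > 0"
    using ne sg finite_subset[OF _ fV, of "\<Union>F"] by (auto simp: card_gt_0_iff subgraph_def)
  ultimately have "2 * real (card F) / real (card (\<Union>F)) \<le> Max ?M"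
    by (intro Max_ge) auto
  also have "\<dots> < 4" using G(2) sg ne by (auto simp: mad_def subgraph_def split: if_splits)
  finally have "2 * real (card F) < 4 * real (card (\<Union>F))"
    using pos by (simp add: divide_less_eq)
  then show ?thesis by linarith
qed auto

section \<open>Cliques in the square of an oriented graph\<close>

lemma sum_card_swap:
  assumes "finite A" "finite B"
  shows "(\<Sum>a\<in>A. card {b\<in>B. R a b}) = (\<Sum>b\<in>B. card {a\<in>A. R a b})"
proof -
  have "(\<Sum>a\<in>A. card {b\<in>B. R a b}) = (\<Sum>a\<in>A. \<Sum>b\<in>B. if R a b then 1 else 0)"
    using assms by (simp add: sum.If_cases Int_def)
  also have "\<dots> = (\<Sum>b\<in>B. \<Sum>a\<in>A. if R a b then 1 else 0)" by (rule sum.swap)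
  also have "\<dots> = (\<Sum>b\<in>B. card {a\<in>A. R a b})"
    using assms by (simp add: sum.If_cases Int_def)
  finally show ?thesis .
qed

text \<open>\<open>out v\<close> is the set of heads of the arcs leaving \<open>v\<close> in an orientation of the graph.\<close>

locale oriented_clique =
  fixes S :: "'a set" and out :: "'a \<Rightarrow> 'a set" and D :: nat
  assumes finS: "finite S"
    and fin_out: "finite (out v)" and card_out: "card (out v) \<le> 2"
    and fin_in: "finite {w. v \<in> out w}"
    and deg: "card (out v) + card {w. v \<in> out w} \<le> D"
    and clique: "\<lbrakk>u \<in> S; v \<in> S; u \<noteq> v\<rbrakk> \<Longrightarrow> v \<in> out u \<or> u \<in> out v \<or>
        (\<exists>w. (w \<in> out u \<or> u \<in> out w) \<and> (w \<in> out v \<or> v \<in> out w))"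
begin

definition d :: "'a \<Rightarrow> nat" where "d h = card {u\<in>S. h \<in> out u}"

definition share :: "'a \<Rightarrow> 'a set" where "share v = {u\<in>S. out u \<inter> out v \<noteq> {}}"

definition below :: "'a \<Rightarrow> 'a set" where "below v = S \<inter> (out v \<union> \<Union>(out ` out v))"

definition above :: "'a \<Rightarrow> 'a set" where "above v = {u\<in>S. v \<in> below u}"

section \<open>Counting around a single clique vertex\<close>

lemma d_le: "d h \<le> D"
proof -
  have "d h \<le> card {w. h \<in> out w}"
    unfolding d_def by (rule card_mono[OF fin_in]) auto
  with deg[of h] show ?thesis by simp
qed

lemma card_below: "card (below v) \<le> 3 * card (out v)"
proof -
  have "card (below v) \<le> card (out v \<union> \<Union>(out ` out v))"
    unfolding below_def using fin_out by (intro card_mono) auto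
  also have "\<dots> \<le> card (out v) + card (\<Union>(out ` out v))" by (rule card_Un_le)
  also have "card (\<Union>(out ` out v)) \<le> (\<Sum>w\<in>out v. card (out w))"
    by (rule card_UN_le[OF fin_out])
  also have "\<dots> \<le> (\<Sum>w\<in>out v. 2)" by (rule sum_mono[OF card_out])
  finally show ?thesis by simp
qed

lemma sum_above: "(\<Sum>v\<in>S. card (above v)) \<le> 6 * card S"
proof -
  have "(\<Sum>v\<in>S. card (above v)) = (\<Sum>u\<in>S. card {v\<in>S. v \<in> below u})"
    unfolding above_def by (rule sum_card_swap[OF finS finS])
  also have "\<dots> \<le> (\<Sum>u\<in>S. 6)"
  proof (rule sum_mono)
    fix u
    have "{v\<in>S. v \<in> below u} = below u" by (auto simp: below_def)
    with card_below[of u] card_out[of u] show "card {v\<in>S. v \<in> below u} \<le> 6" by simp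
  qed
  finally show ?thesis by simp
qed

text \<open>The 4 arises since common in-neighbours give at most \<open>D - card (out v)\<close>
  vertices and \<open>below v\<close> has at most \<open>3 * card (out v)\<close>, together at most
  \<open>D + 2 * card (out v)\<close>.\<close>

lemma clique_bound:
  assumes v: "v \<in> S"
  shows "card S \<le> card (share v) + D + 4 + card (above v)"
proof -
  define J where "J = (\<Union>w\<in>{w. v \<in> out w}. out w - {v})"
  have fS: "finite (share v)" "finite (above v)" "finite (below v)"
    using finS by (auto simp: share_def above_def below_def)
  have fJ: "finite J" unfolding J_def using fin_in fin_out by auto
  \<comment> \<open>One of the at most two out-neighbours of \<open>w\<close> is \<open>v\<close>
    itself, so \<open>w\<close> contributes at most one vertex.\<close>
  have "card J \<le> (\<Sum>w\<in>{w. v \<in> out w}. card (out w - {v}))"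
    unfolding J_def by (rule card_UN_le[OF fin_in])
  also have "\<dots> \<le> (\<Sum>w\<in>{w. v \<in> out w}. 1)"
    using card_out by (intro sum_mono) (simp add: fin_out card_Diff_singleton le_diff_conv numeral_2_eq_2[symmetric])
  finally have J: "card J \<le> card {w. v \<in> out w}" by simp
  have cover: "S - {v} \<subseteq> (share v - {v}) \<union> J \<union> below v \<union> above v"
  proof
    fix u assume u: "u \<in> S - {v}"
    with clique[of u v] v consider "v \<in> out u" | "u \<in> out v" | w where "w \<in> out u" "w \<in> out v"
      | w where "w \<in> out u" "v \<in> out w" | w where "u \<in> out w" "w \<in> out v"
      | w where "u \<in> out w" "v \<in> out w" by auto
    then show "u \<in> (share v - {v}) \<union> J \<union> below v \<union> above v"
      using u v by cases (auto simp: share_def J_def below_def above_def)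
  qed
  have "card (S - {v}) \<le> card ((share v - {v}) \<union> J \<union> below v \<union> above v)"
    using fS fJ by (intro card_mono[OF _ cover]) auto
  also have "\<dots> \<le> card (share v - {v}) + card J + card (below v) + card (above v)"
    by (meson add_le_mono card_Un_le le_refl order_trans)
  finally have 1: "card (S - {v}) \<le> card (share v - {v}) + card J + card (below v) + card (above v)" .
  have 2: "card S = Suc (card (S - {v}))" using v finS by (metis card.remove)
  show ?thesis
  proof (cases "out v = {}")
    case True
    then have "share v = {}" by (simp add: share_def)
    with 1 2 True J card_below[of v] deg[of v] show ?thesis by simp
  next
    case False
    then have "v \<in> share v" using v by (simp add: share_def)
    then have "card (share v) = Suc (card (share v - {v}))" using fS by (metis card.remove)
    with 1 2 J card_below[of v] deg[of v] card_out[of v] show ?thesis by linarith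
  qed
qed

lemma card_share_le_sum: "card (share v) \<le> (\<Sum>h\<in>out v. d h)"
proof -
  have "share v = (\<Union>h\<in>out v. {u\<in>S. h \<in> out u})" by (auto simp: share_def)
  then show ?thesis
    using card_UN_le[OF fin_out[of v], of "\<lambda>h. {u\<in>S. h \<in> out u}"] by (simp add: d_def)
qed

text \<open>Inclusion-exclusion; since outdegrees are at most 2, a vertex using both hubs has no
  other out-neighbour.\<close>

lemma card_share_pair:
  fixes v :: 'a
  assumes "out v = {i, j}" "i \<noteq> j"
  shows "card (share v) + card {u\<in>S. out u = {i, j}} = d i + d j"
proof -
  have "share v = {u\<in>S. i \<in> out u} \<union> {u\<in>S. j \<in> out u}"
    using assms by (auto simp: share_def)
  moreover have "out u = {i, j}" if "i \<in> out u" "j \<in> out u" for u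
    by (rule sym, rule card_seteq[OF fin_out]) (use that assms card_out[of u] in auto)
  then have "{u\<in>S. out u = {i, j}} = {u\<in>S. i \<in> out u} \<inter> {u\<in>S. j \<in> out u}" by auto
  ultimately show ?thesis
    unfolding d_def using card_Un_Int[of "{u\<in>S. i \<in> out u}" "{u\<in>S. j \<in> out u}"] finS by simp
qed

lemma card_share_le: "card (share v) \<le> 2 * D"
proof -
  have "(\<Sum>h\<in>out v. d h) \<le> card (out v) * D" using sum_bounded_above[of "out v" d D] d_le by simp
  also have "\<dots> \<le> 2 * D" using card_out by (rule mult_le_mono1)
  finally show ?thesis using card_share_le_sum[of v] by linarith
qed

text \<open>A crude bound from averaging \<open>clique_bound\<close> over \<open>S\<close>, with 10
  = 4 + 6. If \<open>S\<close> exceeds the target, it forces \<open>D\<close> to be large and bounds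
  the number of big hubs.\<close>

lemma card_S_le: "card S \<le> 3 * D + 10"
proof (cases "card S = 0")
  case False
  have "card S * card S = (\<Sum>v\<in>S. card S)" by simp
  also have "\<dots> \<le> (\<Sum>v\<in>S. 3 * D + 4 + card (above v))"
  proof (rule sum_mono)
    fix v assume "v \<in> S"
    from clique_bound[OF this] card_share_le[of v] show "card S \<le> 3 * D + 4 + card (above v)" by linarith
  qed
  also have "\<dots> = card S * (3 * D + 4) + (\<Sum>v\<in>S. card (above v))" by (simp add: sum.distrib)
  also have "\<dots> \<le> card S * (3 * D + 4) + 6 * card S" using sum_above by simp
  also have "\<dots> = card S * (3 * D + 10)" by (simp add: algebra_simps)
  finally show ?thesis using False by simp
qed simp

section \<open>Hub degrees, and the core of vertices with two big hubs\<close>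

lemma sum_d:
  assumes "finite K" shows "(\<Sum>h\<in>K. d h) = (\<Sum>u\<in>S. card (K \<inter> out u))"
proof -
  have "(\<Sum>h\<in>K. d h) = (\<Sum>u\<in>S. card {h\<in>K. h \<in> out u})"
    unfolding d_def by (rule sum_card_swap[OF assms finS])
  then show ?thesis by (simp add: Int_def)
qed

lemma sum_d_le: "finite K \<Longrightarrow> (\<Sum>h\<in>K. d h) \<le> 2 * card S"
proof -
  assume K: "finite K"
  have "(\<Sum>u\<in>S. card (K \<inter> out u)) \<le> (\<Sum>u\<in>S. 2)"
  proof (rule sum_mono)
    fix u
    have "card (K \<inter> out u) \<le> card (out u)" by (intro card_mono fin_out) auto
    with card_out[of u] show "card (K \<inter> out u) \<le> 2" by linarith
  qed
  with sum_d[OF K] show ?thesis by simp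
qed

text \<open>A vertex of \<open>core\<close> has two big hubs as out-neighbours, and since it is not in \<open>special\<close> only
  vertices of \<open>bad\<close> reach it by a directed path of length at most two. So the error term
  \<open>card (above v)\<close> of \<open>clique_bound\<close>, which is small only on average over \<open>S\<close>, is bounded by a
  constant at every vertex of \<open>core\<close>.\<close>

definition big :: "'a set" where "big = {h. D \<le> 4 * d h}"

definition bad :: "'a set" where
  "bad = {v\<in>S. \<not> (card (out v) = 2 \<and> out v \<subseteq> big)}"

definition special :: "'a set" where
  "special = S \<inter> (big \<union> \<Union>(out ` big))"

definition core :: "'a set" where "core = S - bad - special"

definition hubs :: "'a set" where "hubs = \<Union>(out ` core)"

text \<open>A hub outside \<open>big\<close> adds less than \<open>D / 4\<close> to the at most
  \<open>D\<close> of the other hub. Then \<open>clique_bound\<close> gives about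
  \<open>9 * D / 4\<close>, below the target \<open>5 * D / 2\<close>, unless \<open>above v\<close>
  is large.\<close>

lemma share_bad:
  assumes "v \<in> bad" shows "4 * card (share v) \<le> 5 * D"
proof (cases "card (out v) \<le> 1")
  case True
  have "(\<Sum>h\<in>out v. d h) \<le> card (out v) * D" using sum_bounded_above[of "out v" d D] d_le by simp
  also have "\<dots> \<le> 1 * D" using True by (rule mult_le_mono1)
  finally show ?thesis using card_share_le_sum[of v] by linarith
next
  case False
  then have c: "card (out v) = 2" using card_out[of v] by linarith
  with assms obtain h where h: "h \<in> out v" "h \<notin> big" by (auto simp: bad_def)
  from c h obtain j where "out v = {h, j}" "j \<noteq> h" by (metis card_2_iff insert_commute insertE singletonD)
  then have "card (share v) \<le> d h + d j" using card_share_le_sum[of v] by simp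
  with h d_le[of j] show ?thesis by (simp add: big_def)
qed

text \<open>For \<open>card S\<close> near \<open>5 * D / 2\<close>, each bad vertex forces
  \<open>4 * card (above v)\<close> to be about \<open>D\<close>, while these terms sum to at most
  \<open>24 * card S\<close>, about \<open>60 * D\<close>.\<close>

lemma card_bad:
  assumes "5 * D + 481 \<le> 2 * card S" shows "card bad \<le> 60"
proof (rule ccontr)
  assume b: "\<not> card bad \<le> 60"
  have ineq: "4 * card S \<le> 9 * D + 16 + 4 * card (above v)" if "v \<in> bad" for v
    using clique_bound[of v] share_bad[OF that] that by (simp add: bad_def)
  have "card bad * (4 * card S) = (\<Sum>v\<in>bad. 4 * card S)" by simp
  also have "\<dots> \<le> (\<Sum>v\<in>bad. 9 * D + 16 + 4 * card (above v))" by (rule sum_mono) (rule ineq)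
  also have "\<dots> = card bad * (9 * D + 16) + 4 * (\<Sum>v\<in>bad. card (above v))"
    by (simp add: sum.distrib sum_distrib_left)
  also have "(\<Sum>v\<in>bad. card (above v)) \<le> (\<Sum>v\<in>S. card (above v))"
    by (rule sum_mono2[OF finS]) (auto simp: bad_def)
  finally have "card bad * (4 * card S) \<le> card bad * (9 * D + 16) + 24 * card S"
    using sum_above by linarith
  then have "int (card bad * (4 * card S)) \<le> int (card bad * (9 * D + 16) + 24 * card S)"
    by (rule of_nat_mono)
  then have "int (card bad) * (4 * int (card S) - 9 * int D - 16) \<le> 24 * int (card S)"
    by (simp add: algebra_simps)
  moreover have "61 * (4 * int (card S) - 9 * int D - 16) \<le> int (card bad) * (4 * int (card S) - 9 * int D - 16)"
    using b assms by (intro mult_right_mono) auto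
  moreover have "5 * int D + 481 \<le> 2 * int (card S)" using assms by linarith
  ultimately show False by (simp add: algebra_simps)
qed

text \<open>The degrees of the hubs sum to at most \<open>2 * card S\<close> and a big hub has at
  least \<open>D / 4\<close>, so \<open>card big\<close> is at most \<open>8 * card S / D\<close>,
  less than 25 by \<open>card_S_le\<close>.\<close>

lemma card_big:
  assumes "5 * D + 481 \<le> 2 * card S" shows "finite big" "card big \<le> 24"
proof -
  have D: "D \<ge> 461" using card_S_le assms by linarith
  have le: "card B \<le> 24" if "finite B" "B \<subseteq> big" for B
  proof -
    have "card B * D \<le> (\<Sum>h\<in>B. 4 * d h)"
      using sum_bounded_below[of B D "\<lambda>h. 4 * d h"] that by (auto simp: big_def)
    also have "\<dots> \<le> 8 * card S" using sum_d_le[OF that(1)] by (simp flip: sum_distrib_left)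
    also have "\<dots> < 25 * D" using card_S_le D by linarith
    finally show ?thesis by simp
  qed
  show "finite big"
  proof (rule ccontr)
    assume "infinite big"
    then obtain B where "B \<subseteq> big" "finite B" "card B = 25" by (meson infinite_arbitrarily_large)
    with le[of B] show False by simp
  qed
  with le[of big] show "card big \<le> 24" by simp
qed

lemma card_special:
  assumes "5 * D + 481 \<le> 2 * card S" shows "card special \<le> 72"
proof -
  have "card special \<le> card (big \<union> \<Union>(out ` big))"
    unfolding special_def using card_big[OF assms] fin_out by (intro card_mono) auto
  also have "\<dots> \<le> card big + card (\<Union>(out ` big))" by (rule card_Un_le)
  also have "card (\<Union>(out ` big)) \<le> (\<Sum>w\<in>big. card (out w))"
    by (rule card_UN_le[OF card_big(1)[OF assms]])
  also have "\<dots> \<le> (\<Sum>w\<in>big. 2)" by (rule sum_mono[OF card_out])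
  finally show ?thesis using card_big(2)[OF assms] by simp
qed

text \<open>Unless \<open>u\<close> is in \<open>bad\<close>, all its out-neighbours are big, so
  whatever lies below \<open>u\<close> is in \<open>special\<close>.\<close>

lemma above_core: "v \<in> core \<Longrightarrow> above v \<subseteq> bad"
  unfolding core_def above_def below_def bad_def special_def by blast

lemma core_bound:
  assumes "5 * D + 481 \<le> 2 * card S" "v \<in> core"
  shows "card S \<le> card (share v) + D + 64"
proof -
  have "card (above v) \<le> card bad"
    using above_core[OF assms(2)] finS by (intro card_mono) (auto simp: bad_def)
  with clique_bound[of v] card_bad[OF assms(1)] assms(2) show ?thesis by (simp add: core_def)
qed

lemma core_edge:
  assumes "v \<in> core" "i \<in> out v"
  obtains j where "out v = {i, j}" "j \<noteq> i" "j \<in> hubs"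
proof -
  have "card (out v) = 2" using assms(1) by (auto simp: core_def bad_def)
  then obtain j where "out v = {i, j}" "j \<noteq> i"
    using assms(2) by (metis card_2_iff insert_commute insertE singletonD)
  moreover from this have "j \<in> hubs" using assms(1) by (auto simp: hubs_def)
  ultimately show ?thesis using that by blast
qed

text \<open>The 132 exceptions are 60 from \<open>card_bad\<close> and 72 from
  \<open>card_special\<close>.\<close>

lemma core_size:
  assumes "5 * D + 481 \<le> 2 * card S" "T \<subseteq> S"
  shows "card T \<le> card (T \<inter> core) + 132"
proof -
  have fin: "finite bad" "finite special" "finite T"
    using finS assms(2) by (auto simp: bad_def special_def intro: finite_subset)
  have "card T \<le> card ((T \<inter> core) \<union> (bad \<union> special))"
    using fin assms(2) by (intro card_mono) (auto simp: core_def)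
  also have "\<dots> \<le> card (T \<inter> core) + (card bad + card special)"
    by (meson add_le_mono card_Un_le le_refl order_trans)
  finally show ?thesis using card_bad[OF assms(1)] card_special[OF assms(1)] by linarith
qed

lemma finite_hubs: "finite hubs"
  unfolding hubs_def core_def using finS fin_out by auto

text \<open>Five hubs have total degree at most \<open>5 * D\<close> and every core vertex uses two
  hubs, so the core would have at most \<open>5 * D / 2\<close> vertices.\<close>

lemma card_hubs:
  assumes N: "5 * D + 481 \<le> 2 * card S" shows "card hubs \<ge> 6"
proof (rule ccontr)
  assume "\<not> 6 \<le> card hubs"
  then have k: "card hubs \<le> 5" by simp
  have fc: "finite core" unfolding core_def using finS by simp
  have "2 * card core = (\<Sum>v\<in>core. card (hubs \<inter> out v))"
  proof -
    have "card (hubs \<inter> out v) = 2" if "v \<in> core" for v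
    proof -
      have "hubs \<inter> out v = out v" using that by (auto simp: hubs_def)
      then show ?thesis using that by (simp add: core_def bad_def)
    qed
    then show ?thesis by simp
  qed
  also have "\<dots> \<le> (\<Sum>v\<in>S. card (hubs \<inter> out v))"
    by (rule sum_mono2[OF finS]) (auto simp: core_def)
  also have "\<dots> = (\<Sum>h\<in>hubs. d h)" by (rule sum_d[OF finite_hubs, symmetric])
  also have "\<dots> \<le> card hubs * D" using sum_bounded_above[of hubs d D] d_le by simp
  also have "\<dots> \<le> 5 * D" using k by (rule mult_le_mono1)
  finally have "2 * card core \<le> 5 * D" .
  moreover have "card S \<le> card core + 132"
  proof -
    have "S \<inter> core = core" by (auto simp: core_def)
    then show ?thesis using core_size[OF N, of S] by simp
  qed
  ultimately show False using N by linarith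
qed

section \<open>Linear programming on the hub degrees\<close>

theorem card_S_bound: "2 * card S \<le> 5 * D + 480"
proof (rule ccontr)
  assume "\<not> 2 * card S \<le> 5 * D + 480"
  then have N: "5 * D + 481 \<le> 2 * card S" by simp
  have K6: "card hubs \<ge> 6" by (rule card_hubs[OF N])
  then have "hubs \<noteq> {}" by auto
  then obtain i where i: "i \<in> hubs" and i_min: "\<And>h. h \<in> hubs \<Longrightarrow> d i \<le> d h"
    using ex_min_if_finite[of "d ` hubs"] finite_hubs
    by (metis (no_types, lifting) arg_min_if_finite(1) arg_min_least)
  define Nb where "Nb = {j\<in>hubs. j \<noteq> i \<and> (\<exists>v\<in>core. out v = {i, j})}"
  define m where "m j = card {u\<in>S. out u = {i, j}}" for j
  have fNb: "finite Nb" "Nb \<subseteq> hubs - {i}" using finite_hubs by (auto simp: Nb_def)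
  have edge: "card S + m j \<le> d i + d j + D + 64" if j: "j \<in> Nb" for j
  proof -
    from j obtain v where v: "v \<in> core" "out v = {i, j}" "i \<noteq> j" by (auto simp: Nb_def)
    from core_bound[OF N v(1)] card_share_pair[OF v(2,3)] show ?thesis by (simp add: m_def)
  qed
  have deg_i: "d i \<le> (\<Sum>j\<in>Nb. m j) + 132"
  proof -
    have "{u\<in>S. i \<in> out u} \<inter> core \<subseteq> (\<Union>j\<in>Nb. {u\<in>S. out u = {i, j}})"
    proof
      fix u assume u: "u \<in> {u\<in>S. i \<in> out u} \<inter> core"
      then obtain j where "out u = {i, j}" "j \<noteq> i" "j \<in> hubs" using core_edge by blast
      with u show "u \<in> (\<Union>j\<in>Nb. {u\<in>S. out u = {i, j}})" by (auto simp: Nb_def)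
    qed
    then have "card ({u\<in>S. i \<in> out u} \<inter> core) \<le> card (\<Union>j\<in>Nb. {u\<in>S. out u = {i, j}})"
      using fNb finS by (intro card_mono) auto
    also have "\<dots> \<le> (\<Sum>j\<in>Nb. m j)" unfolding m_def by (rule card_UN_le[OF fNb(1)])
    finally show ?thesis using core_size[OF N, of "{u\<in>S. i \<in> out u}"] by (auto simp: d_def)
  qed
  have "Nb \<noteq> {}"
  proof -
    from i obtain v where v: "v \<in> core" "i \<in> out v" by (auto simp: hubs_def)
    then obtain j where "out v = {i, j}" "j \<noteq> i" "j \<in> hubs" by (rule core_edge)
    with v have "j \<in> Nb" by (auto simp: Nb_def)
    then show ?thesis by auto
  qed
  define s where "s = int (card Nb)"
  define n where "n = int (card (hubs - {i}))"
  define x where "x = int (d i)"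
  \<comment> \<open>With this shift, \<open>edge\<close> reads
    \<open>y + m j \<le> x + d j\<close>.\<close>
  define y where "y = int (card S) - int D - 64"
  have n5: "n \<ge> 5" using K6 i finite_hubs by (simp add: n_def)
  have sn: "s \<le> n" unfolding s_def n_def using fNb finite_hubs by (simp add: card_mono)
  have x_low: "x \<ge> y - int D"
  proof -
    from \<open>Nb \<noteq> {}\<close> obtain j where "j \<in> Nb" by auto
    from edge[OF this] d_le[of j] show ?thesis by (simp add: x_def y_def)
  qed
  have all: "x + (\<Sum>j\<in>hubs - {i}. int (d j)) \<le> 2 * int (card S)"
  proof -
    have "d i + (\<Sum>j\<in>hubs - {i}. d j) \<le> 2 * card S"
      using sum_d_le[OF finite_hubs] i finite_hubs by (simp add: sum.remove[of hubs i d])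
    then show ?thesis unfolding x_def by (simp flip: of_nat_sum of_nat_add)
  qed
  have m_sum: "x - 132 \<le> (\<Sum>j\<in>Nb. int (m j))"
    using deg_i unfolding x_def by (simp flip: of_nat_sum)
  have split: "(\<Sum>j\<in>hubs - {i}. int (d j)) = (\<Sum>j\<in>Nb. int (d j)) + (\<Sum>j\<in>hubs - {i} - Nb. int (d j))"
    using fNb finite_hubs by (subst sum.subset_diff[of Nb]) auto
  have rest: "(n - s) * x \<le> (\<Sum>j\<in>hubs - {i} - Nb. int (d j))"
  proof -
    have "int (card (hubs - {i} - Nb)) = n - s"
      unfolding n_def s_def using fNb by (simp add: card_Diff_subset card_mono finite_hubs of_nat_diff)
    moreover have "of_nat (card (hubs - {i} - Nb)) * x \<le> (\<Sum>j\<in>hubs - {i} - Nb. int (d j))"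
      by (rule sum_bounded_below) (use i_min in \<open>auto simp: x_def\<close>)
    ultimately show ?thesis by simp
  qed
  have nbrs: "s * (y - x) + (x - 132) \<le> (\<Sum>j\<in>Nb. int (d j))"
  proof -
    have "(\<Sum>j\<in>Nb. (y - x) + int (m j)) \<le> (\<Sum>j\<in>Nb. int (d j))"
      by (rule sum_mono) (use edge in \<open>fastforce simp: x_def y_def\<close>)
    then show ?thesis using m_sum by (simp add: sum.distrib s_def)
  qed
  \<comment> \<open>\<open>x\<close> is the minimal hub degree, \<open>s\<close> the number of hubs that share a core vertex with the hub
    \<open>i\<close> attaining it. Linear programming in \<open>x\<close>, \<open>s\<close>, \<open>n\<close>; the extremal case is \<open>s = n = 5\<close>
    with all six hubs of degree \<open>5 * D / 6\<close>.\<close>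
  have I1: "s * (y - 2 * x) + (n + 2) * x \<le> 2 * int (card S) + 132"
    using all split rest nbrs by (simp add: algebra_simps)
  \<comment> \<open>As \<open>d j \<le> D\<close>, \<open>edge\<close> also caps each
    \<open>m j\<close>, so few neighbours cannot account for \<open>d i\<close>.\<close>
  have I2: "x - 132 \<le> s * (x - y + int D)"
  proof -
    have "(\<Sum>j\<in>Nb. int (m j)) \<le> of_nat (card Nb) * (x - y + int D)"
    proof (rule sum_bounded_above)
      fix j assume "j \<in> Nb"
      from edge[OF this] d_le[of j] show "int (m j) \<le> x - y + int D" by (simp add: x_def y_def)
    qed
    with m_sum show ?thesis by (simp add: s_def)
  qed
  have I3: "(n + 1) * x \<le> 2 * int (card S)"
  proof -
    have "of_nat (card (hubs - {i})) * x \<le> (\<Sum>j\<in>hubs - {i}. int (d j))"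
      by (rule sum_bounded_below) (use i_min in \<open>auto simp: x_def\<close>)
    with all show ?thesis by (simp add: n_def algebra_simps)
  qed
  have x0: "x \<ge> 0" by (simp add: x_def)
  have N': "5 * int D + 481 \<le> 2 * int (card S)" using N by linarith
  note lin = N' y_def x0 x_low of_nat_0_le_iff[of D, where ?'a = int]
  \<comment> \<open>In \<open>I1\<close> the coefficient of \<open>s\<close> is
    \<open>y - 2 * x\<close>; its sign decides whether the largest or the smallest \<open>s\<close>
    is the worst case.\<close>
  show False
  proof (cases "y \<le> 2 * x")
    case True
    show False
    proof (cases "n = 5")
      case True
      have "5 * (y - 2 * x) \<le> s * (y - 2 * x)"
        using sn True \<open>y \<le> 2 * x\<close> by (intro mult_right_mono_neg) auto
      then show False using I1 I3 True lin by (simp add: algebra_simps)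
    next
      case False
      \<comment> \<open>There are at least seven hubs, so \<open>7 * x \<le> 2 * card S\<close>;
        with \<open>y \<le> 2 * x\<close> this keeps \<open>card S\<close> to about
        \<open>7 * D / 3\<close>.\<close>
      then have "7 * x \<le> (n + 1) * x" using n5 x0 by (intro mult_right_mono) auto
      then show False using I3 True lin by linarith
    qed
  next
    case False
    have n7: "7 * x \<le> (n + 2) * x" using n5 x0 by (intro mult_right_mono) auto
    \<comment> \<open>\<open>I2\<close> settles few neighbours and \<open>I1\<close> many. The case
      \<open>s \<ge> 4\<close> gives \<open>card S < 7 * D / 3 + 238\<close>, the largest additive
      constant among the cases.\<close>
    consider "s \<le> 2" | "s = 3" | "s \<ge> 4" by linarith
    then show False
    proof cases
      case 1
      then have "s * (x - y + int D) \<le> 2 * (x - y + int D)"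
        using x_low by (intro mult_right_mono) auto
      with I2 have "x - 132 \<le> 2 * (x - y + int D)" by (rule order_trans)
      then have "2 * y \<le> x + 2 * int D + 132" by simp
      then show False using False lin by linarith
    next
      case 2
      then show False using I1 I2 n7 False lin by simp
    next
      case 3
      then have "4 * (y - 2 * x) \<le> s * (y - 2 * x)"
        using False by (intro mult_right_mono) auto
      with n7 have "4 * y - x \<le> 2 * int (card S) + 132" using I1 by simp
      then show False using False lin by linarith
    qed
  qed
qed

end

section \<open>Sparse graphs and the 2-degenerate example\<close>

lemma sq_clique_card_le:
  assumes G: "simple_graph V E" "mad V E < 4" "max_degree V E \<le> D" and S: "sq_clique V E S"
  shows "2 * card S \<le> 5 * D + 480"
proof -
  have fV: "finite V" using G(1) by (simp add: simple_graph_def)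
  have EV: "u \<in> V" "v \<in> V" "u \<noteq> v" if "{u, v} \<in> E" for u v
    using G(1) that unfolding simple_graph_def by (metis doubleton_eq_iff)+
  have "E \<subseteq> Pow V" using G(1) unfolding simple_graph_def by auto
  then have fE: "finite E" using fV finite_subset by auto
  have "\<exists>f. (\<forall>e\<in>E. f e \<in> e) \<and> (\<forall>x. card {e\<in>E. f e = x} \<le> 2)"
  proof (rule bounded_choice[where A = "\<lambda>e. e"])
    show "finite e" if "e \<in> E" for e using that \<open>E \<subseteq> Pow V\<close> fV finite_subset[of e V] by auto
    show "card J \<le> 2 * card (\<Union>((\<lambda>e. e) ` J))" if "J \<subseteq> E" for J
      using mad_less_imp_card_le[OF G(1,2) that] by simp
  qed (rule fE)
  then obtain f where f: "\<And>e. e \<in> E \<Longrightarrow> f e \<in> e" and f2: "\<And>x. card {e\<in>E. f e = x} \<le> 2"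
    by blast
  define out where "out v = {u. {v, u} \<in> E \<and> f {v, u} = v}" for v
  have adj: "{u, v} \<in> E \<longleftrightarrow> v \<in> out u \<or> u \<in> out v" for u v
    using f[of "{u, v}"] by (auto simp: out_def insert_commute)
  have outV: "out v \<subseteq> V" "{w. v \<in> out w} \<subseteq> V" for v
    using EV by (auto simp: out_def)
  have fin: "finite (out v)" "finite {w. v \<in> out w}" for v
    using outV[of v] fV by (auto intro: finite_subset)
  \<comment> \<open>An edge has a single tail, so in- and outdegree add up to the degree.\<close>
  have disj: "out v \<inter> {w. v \<in> out w} = {}" for v
    using EV(3) by (fastforce simp: out_def insert_commute)
  have nbh: "out v \<union> {w. v \<in> out w} = {u. {u, v} \<in> E}" for v
    using adj by auto
  have deg: "card (out v) + card {w. v \<in> out w} \<le> D" for v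
  proof -
    have "card (out v) + card {w. v \<in> out w} = degree E v"
      unfolding degree_def nbh[symmetric] by (rule card_Un_disjoint[symmetric, OF fin disj])
    also have "\<dots> \<le> D"
    proof (cases "v \<in> V")
      case True
      then have "degree E v \<le> max_degree V E" using fV by (auto simp: max_degree_def)
      then show ?thesis using G(3) by simp
    next
      case False
      then have "{u. {u, v} \<in> E} = {}" using EV by blast
      then show ?thesis by (simp add: degree_def)
    qed
    finally show ?thesis .
  qed
  have card2: "card (out v) \<le> 2" for v
  proof -
    have "card (out v) \<le> card {e\<in>E. f e = v}"
      by (rule card_inj_on_le[where f = "\<lambda>u. {v, u}"])
        (use fE in \<open>auto simp: out_def inj_on_def doubleton_eq_iff\<close>)
    with f2[of v] show ?thesis by simp
  qed
  interpret oriented_clique S out D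
  proof
    show "finite S" using S fV by (auto simp: sq_clique_def intro: finite_subset)
    show "v \<in> out u \<or> u \<in> out v \<or> (\<exists>w. (w \<in> out u \<or> u \<in> out w) \<and> (w \<in> out v \<or> v \<in> out w))"
      if "u \<in> S" "v \<in> S" "u \<noteq> v" for u v
      using S that unfolding sq_clique_def sq_adj_def adj by blast
  qed (fact fin card2 deg)+
  show ?thesis by (rule card_S_bound)
qed

lemma g_le: "2 * g D \<le> 5 * D + 480"
proof -
  let ?C = "{card S | (V :: nat set) E S. simple_graph V E \<and> mad V E < 4 \<and>
                max_degree V E \<le> D \<and> sq_clique V E S}"
  have "card {} \<in> ?C"
    by (rule CollectI, intro exI[of _ "{}"])
      (simp add: simple_graph_def mad_def max_degree_def sq_clique_def)
  then have "?C \<noteq> {}" by blast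
  then have "Sup ?C \<le> (5 * D + 480) div 2"
    by (rule cSup_least) (use sq_clique_card_le in fastforce)
  then show ?thesis unfolding g_def by linarith
qed

text \<open>Extremal example: five hubs, one type of clique vertex for each of the ten pairs of hubs,
  about \<open>D / 4\<close> clique vertices of each type, and a private vertex of degree two between any two
  clique vertices whose pairs of hubs are disjoint.\<close>

definition tips :: "nat \<Rightarrow> nat set" where
  "tips t = (if t < 5 then {t, (t + 1) mod 5} else {t - 5, (t + 2) mod 5})"

lemma tips_less: "t < 10 \<Longrightarrow> tips t \<subseteq> {..<5}"
  by (auto simp: tips_def)

lemma card_tips: "card (tips t) \<le> 2"
  by (simp add: tips_def card_insert_if)

lemma card_filter_less: "card {t. t < n \<and> P t} = length (filter P [0..<n])"
proof -
  have "{t. t < n \<and> P t} = set (filter P [0..<n])" by auto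
  then show ?thesis by (simp only: distinct_card distinct_filter distinct_upt)
qed

text \<open>\<open>tips\<close> lists the edges of K5 as the sides and then the diagonals of a
  pentagon; 4 is the degree in K5.\<close>

lemma card_tips_containing: "a < 5 \<Longrightarrow> card {t. t < 10 \<and> a \<in> tips t} = 4"
proof -
  have "\<forall>a\<in>{..<5}. length (filter (\<lambda>t. a \<in> tips t) [0..<10]) = 4"
    by (simp add: lessThan_nat_numeral upt_rec tips_def)
  then show "a < 5 \<Longrightarrow> card {t. t < 10 \<and> a \<in> tips t} = 4"
    by (simp add: card_filter_less)
qed

text \<open>Disjointness of the ten pairs is adjacency in the Petersen graph, which is
  3-regular.\<close>

lemma card_tips_disjoint: "t < 10 \<Longrightarrow> card {s. s < 10 \<and> tips t \<inter> tips s = {}} = 3"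
proof -
  have "\<forall>t\<in>{..<10}. length (filter (\<lambda>s. tips t \<inter> tips s = {}) [0..<10]) = 3"
    by (simp add: lessThan_nat_numeral upt_rec tips_def)
  then show "t < 10 \<Longrightarrow> card {s. s < 10 \<and> tips t \<inter> tips s = {}} = 3"
    by (simp add: card_filter_less)
qed

lemma card_residues:
  "card {i. i < 10 * q \<and> P (i mod 10)} = q * card {t. t < (10::nat) \<and> P t}"
proof -
  have "bij_betw (\<lambda>(r, t). 10 * r + t) ({..<q} \<times> {t. t < 10 \<and> P t}) {i. i < 10 * q \<and> P (i mod 10)}"
    by (rule bij_betw_byWitness[where f' = "\<lambda>i. (i div 10, i mod 10)"]) auto
  then show ?thesis by (auto dest: bij_betw_same_card simp: card_cartesian_product)
qed

lemma degenerate_graph_exists: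
  assumes D: "8 \<le> D"
  shows "\<exists>(V :: nat set) E S. simple_graph V E \<and> degenerate 2 V E \<and> max_degree V E \<le> D \<and>
           sq_clique V E S \<and> card S = 10 * (D div 4)"
proof -
  define q where "q = D div 4"
  define n where "n = 10 * q"
  \<comment> \<open>Hubs are the numbers below 5, clique vertices the next \<open>n\<close>, and
    private vertices lie beyond, so the three kinds are disjoint.\<close>
  define s where "s i = 5 + i" for i :: nat
  define c where "c i j = 5 + n + prod_encode (i, j)" for i j
  define R where "R i j \<longleftrightarrow> i < n \<and> j < n \<and> tips (i mod 10) \<inter> tips (j mod 10) = {}" for i j
  \<comment> \<open>A private vertex has the smaller index first, so that both its neighbours name
    the same vertex; the other \<open>c i j\<close> in \<open>V\<close> are isolated.\<close>
  define A where "A u i \<longleftrightarrow> i < n \<and> (u \<in> tips (i mod 10) \<or>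
      (\<exists>j. R i j \<and> u = (if i < j then c i j else c j i)))" for u i
  define E where "E = {{u, s i} | u i. A u i}"
  define V where "V = {..<5} \<union> s ` {..<n} \<union> (\<lambda>(i, j). c i j) ` ({..<n} \<times> {..<n})"
  have tips: "tips (i mod 10) \<subseteq> {..<5}" for i by (rule tips_less) simp
  have ne: "a < 5 \<Longrightarrow> a \<noteq> s i" "a < 5 \<Longrightarrow> a \<noteq> c i j" "i' < n \<Longrightarrow> c i j \<noteq> s i'"
    "s i = s i' \<longleftrightarrow> i = i'" "c i j = c i' j' \<longleftrightarrow> i = i' \<and> j = j'" for a i j i' j'
    by (auto simp: s_def c_def)
  have RD: "i < n" "j < n" "R j i" if "R i j" for i j using that by (auto simp: R_def)
  have adj: "{u, v} \<in> E \<longleftrightarrow> (\<exists>i. v = s i \<and> A u i) \<or> (\<exists>i. u = s i \<and> A v i)" for u v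
    unfolding E_def mem_Collect_eq doubleton_eq_iff by metis
  have A_V: "u \<in> V" "i < n" "u \<notin> s ` {..<n}" if Aui: "A u i" for u i
  proof -
    consider "i < n" "u \<in> tips (i mod 10)" | j where "R i j" "u = (if i < j then c i j else c j i)" "i < n"
      using Aui unfolding A_def by blast
    then have "u \<in> V \<and> i < n \<and> u \<notin> s ` {..<n}"
    proof cases
      case 1
      then have "u < 5" using tips[of i] by auto
      then show ?thesis using 1 ne(1)[of u] by (auto simp: V_def)
    next
      case 2
      then show ?thesis using RD[of i j] ne(3) by (auto simp: V_def)
    qed
    then show "u \<in> V" "i < n" "u \<notin> s ` {..<n}" by auto
  qed
  have nbh_hub: "{u. {u, a} \<in> E} \<subseteq> s ` {i. i < n \<and> a \<in> tips (i mod 10)}" if a: "a < 5" for a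
  proof
    fix u assume "u \<in> {u. {u, a} \<in> E}"
    then obtain i where "u = s i" "A a i" using ne(1)[OF a] by (auto simp: adj)
    then show "u \<in> s ` {i. i < n \<and> a \<in> tips (i mod 10)}"
      using ne(2)[OF a] by (auto simp: A_def split: if_splits)
  qed
  have nbh_s: "{u. {u, s i} \<in> E} \<subseteq> tips (i mod 10) \<union>
      (\<lambda>j. if i < j then c i j else c j i) ` {j. j < n \<and> tips (i mod 10) \<inter> tips (j mod 10) = {}}"
    (is "_ \<subseteq> ?B") if "i < n" for i
  proof
    fix u assume "u \<in> {u. {u, s i} \<in> E}"
    then have "A u i" using A_V(3)[of "s i"] that by (auto simp: adj ne)
    then consider "u \<in> tips (i mod 10)" | j where "R i j" "u = (if i < j then c i j else c j i)"
      unfolding A_def by blast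
    then show "u \<in> ?B"
    proof cases
      case 2
      then have "j \<in> {j. j < n \<and> tips (i mod 10) \<inter> tips (j mod 10) = {}}" by (simp add: R_def)
      with 2(2) show ?thesis by blast
    qed blast
  qed
  have nbh_c: "{u. {u, c i j} \<in> E} \<subseteq> {s i, s j}" for i j
  proof
    fix u assume "u \<in> {u. {u, c i j} \<in> E}"
    then obtain k where k: "u = s k" "A (c i j) k" using A_V(2) ne(3) by (fastforce simp: adj)
    have "c i j \<notin> tips (k mod 10)" using tips[of k] ne(2) by blast
    with k show "u \<in> {s i, s j}" by (auto simp: A_def ne(5) split: if_splits)
  qed
  have simple: "simple_graph V E"
  proof -
    have "\<exists>u v. u \<in> V \<and> v \<in> V \<and> u \<noteq> v \<and> e = {u, v}" if "e \<in> E" for e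
    proof -
      from that obtain u i where e: "e = {u, s i}" and u: "A u i" unfolding E_def by blast
      from A_V[OF u] have "s i \<in> V" "u \<noteq> s i" by (auto simp: V_def)
      with e A_V(1)[OF u] show ?thesis by blast
    qed
    then show ?thesis unfolding simple_graph_def by (simp add: V_def)
  qed
  \<comment> \<open>A clique vertex has two hubs and at most \<open>3 * q\<close> private
    neighbours. That bound follows from \<open>q \<ge> 2\<close>, which \<open>8 \<le> D\<close>
    guarantees.\<close>
  have qD: "4 * q \<le> D" "3 * q + 2 \<le> D" "2 \<le> D" using D unfolding q_def by linarith+
  have "degree E v \<le> D" if "v \<in> V" for v
  proof -
    from that consider "v < 5" | i where "i < n" "v = s i" | i j where "v = c i j"
      unfolding V_def by auto
    then show ?thesis
    proof cases
      case 1
      have "degree E v \<le> card (s ` {i. i < n \<and> v \<in> tips (i mod 10)})"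
        unfolding degree_def by (rule card_mono[OF _ nbh_hub[OF 1]]) simp
      also have "\<dots> \<le> card {i. i < n \<and> v \<in> tips (i mod 10)}" by (rule card_image_le) simp
      also have "\<dots> = q * 4" unfolding n_def
        using card_residues[of q "\<lambda>t. v \<in> tips t"] card_tips_containing[OF 1] by simp
      finally show ?thesis using qD by simp
    next
      case 2
      let ?J = "{j. j < n \<and> tips (i mod 10) \<inter> tips (j mod 10) = {}}"
      have "degree E v \<le> card (tips (i mod 10) \<union> (\<lambda>j. if i < j then c i j else c j i) ` ?J)"
        unfolding degree_def \<open>v = s i\<close>
        by (rule card_mono[OF _ nbh_s[OF \<open>i < n\<close>]]) (auto intro: finite_subset[OF tips])
      also have "\<dots> \<le> card (tips (i mod 10)) + card ?J"
        by (intro order_trans[OF card_Un_le] add_left_mono card_image_le) simp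
      also have "card ?J = q * 3"
        unfolding n_def using card_tips_disjoint[of "i mod 10"]
          card_residues[of q "\<lambda>t. tips (i mod 10) \<inter> tips t = {}"] by simp
      finally show ?thesis using qD card_tips[of "i mod 10"] by simp
    next
      case 3
      have "degree E v \<le> card {s i, s j}"
        unfolding degree_def 3 by (rule card_mono[OF _ nbh_c]) simp
      then show ?thesis using qD by (simp add: card_insert_if split: if_splits)
    qed
  qed
  then have maxdeg: "max_degree V E \<le> D"
    using simple by (auto simp: max_degree_def simple_graph_def)
  \<comment> \<open>Remove private vertices first, as they have degree at most 2; a clique vertex
    then keeps only its two hubs, and hubs are pairwise nonadjacent.\<close>
  have degen: "degenerate 2 V E"
    unfolding degenerate_def
  proof (intro allI impI, elim conjE)
    fix W F assume sg: "subgraph W F V E" and W: "W \<noteq> {}"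
    have F: "{u. {u, v} \<in> F} \<subseteq> {u. {u, v} \<in> E} \<inter> W" for v
      using sg by (auto simp: subgraph_def)
    have le2: "\<exists>v\<in>W. card {u. {u, v} \<in> F} \<le> 2"
      if "v \<in> W" "{u. {u, v} \<in> F} \<subseteq> B" "finite B" "card B \<le> 2" for v B
      using that card_mono[OF that(3,2)] by (intro bexI[of _ v]) auto
    show "\<exists>v\<in>W. card {u. {u, v} \<in> F} \<le> 2"
    proof (cases "\<exists>i j. c i j \<in> W")
      case True
      then obtain i j where ij: "c i j \<in> W" by blast
      show ?thesis
        by (rule le2[OF ij order_trans[OF F order_trans[OF Int_lower1 nbh_c]]])
          (auto simp: card_insert_if)
    next
      case noc: False
      show ?thesis
      proof (cases "\<exists>i<n. s i \<in> W")
        case True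
        then obtain i where i: "i < n" "s i \<in> W" by blast
        have "{u. {u, s i} \<in> F} \<subseteq> tips (i mod 10)"
        proof
          fix u assume "u \<in> {u. {u, s i} \<in> F}"
          then have "u \<in> W" "{u, s i} \<in> E" using F[of "s i"] by auto
          then show "u \<in> tips (i mod 10)" using nbh_s[OF i(1)] noc by (auto split: if_splits)
        qed
        then show ?thesis
          by (rule le2[OF i(2)]) (auto simp: card_tips intro: finite_subset[OF tips])
      next
        case False
        obtain a where a: "a \<in> W" using W by blast
        then have "a < 5" using sg noc False by (auto simp: subgraph_def V_def)
        then have "{u. {u, a} \<in> F} \<subseteq> {}"
          using F[of a] nbh_hub[of a] False by blast
        then show ?thesis by (rule le2[OF a]) auto
      qed
    qed
  qed
  have clique: "sq_clique V E (s ` {..<n})"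
    unfolding sq_clique_def
  proof (intro conjI ballI impI)
    show "s ` {..<n} \<subseteq> V" by (auto simp: V_def)
    fix u v assume "u \<in> s ` {..<n}" "v \<in> s ` {..<n}" "u \<noteq> v"
    then obtain i j where ij: "i < n" "j < n" "i \<noteq> j" and uv: "u = s i" "v = s j" by auto
    show "sq_adj V E u v"
    proof (cases "tips (i mod 10) \<inter> tips (j mod 10) = {}")
      case False
      then obtain a where a: "a \<in> tips (i mod 10)" "a \<in> tips (j mod 10)" by blast
      then have "a \<in> V" using tips[of i] by (auto simp: V_def)
      moreover have "{s i, a} \<in> E" "{a, s j} \<in> E"
        using a ij by (auto simp: adj A_def)
      ultimately show ?thesis using \<open>u \<noteq> v\<close> uv by (auto simp: sq_adj_def)
    next
      case True
      then have R: "R i j" "R j i" using ij by (auto simp: R_def)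
      define w where "w = (if i < j then c i j else c j i)"
      have "w \<in> V" using ij by (auto simp: V_def w_def)
      moreover have "w = (if j < i then c j i else c i j)" using ij by (simp add: w_def)
      then have "A w i" "A w j" unfolding A_def using R ij w_def by blast+
      then have "{w, s i} \<in> E" "{w, s j} \<in> E" unfolding adj by blast+
      ultimately show ?thesis using \<open>u \<noteq> v\<close> uv by (auto simp: sq_adj_def insert_commute)
    qed
  qed
  have "card (s ` {..<n}) = 10 * (D div 4)"
    by (subst card_image) (auto simp: inj_on_def s_def n_def q_def)
  with simple degen maxdeg clique show ?thesis by blast
qed

theorem theorem4:
  fixes D :: nat
  assumes "D \<ge> 1"
  shows "\<exists>(V :: nat set) E S'. simple_graph V E \<and> degenerate 2 V E \<and> max_degree V E \<le> D \<and>
           sq_clique V E S' \<and> int (card S') \<ge> int (g D) - 460"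
proof (cases "8 \<le> D")
  case True
  then obtain V :: "nat set" and E S' where "simple_graph V E" "degenerate 2 V E"
    "max_degree V E \<le> D" "sq_clique V E S'" and S: "card S' = 10 * (D div 4)"
    using degenerate_graph_exists by blast
  \<comment> \<open>\<open>10 * (D div 4)\<close> is at most 7.5 below \<open>5 * D / 2\<close>, so
    the gap to \<open>g D\<close> is less than 248.\<close>
  moreover have "int (card S') \<ge> int (g D) - 460" using g_le[of D] S by linarith
  ultimately show ?thesis by blast
next
  case False
  \<comment> \<open>For \<open>D \<le> 7\<close> the bound gives \<open>g D \<le> 257\<close>, so
    the empty graph suffices.\<close>
  then have "int (card {}) \<ge> int (g D) - 460" using g_le[of D] by simp
  then show ?thesis
    by (intro exI[of _ "{}"])
      (simp add: simple_graph_def degenerate_def subgraph_def max_degree_def sq_clique_def)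
qed

end
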